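(* Let $\delta$ be a valley-free range map and $\mathcal{S}$ be a graded subset of $\mathsf{Cl}_\delta$. If $\mathcal{S}$ is closed by prefix and is closed by suffix reduction, then $\mathbf{Cl}_{\mathcal{S}}$ is a quotient algebra of the unital associative algebra $\mathbf{Cl}_\delta$.
   Context: A range map is a map $\delta : \mathbb{N}\setminus\{0\} \to \mathbb{N}$ (with $0 \in \mathbb{N}$). It is valley-free if there are no $1 \leq i_1 < i_2 < i_3$ such that $\delta(i_1) > \delta(i_2) < \delta(i_3)$. A $\delta$-cliff of size $n$ is a word $u = u_1 \cdots u_n$ of integers with $0 \leq u_i \leq \delta(i)$ for all $1 \leq i \leq n$; $\mathsf{Cl}_\delta(n)$ is the set of $\delta$-cliffs of size $n$ and $\mathsf{Cl}_\delta = \bigsqcup_{n\geq 0} \mathsf{Cl}_\delta(n)$. Let $\mathbb{K}$ be a field of characteristic zero. $\mathbf{Cl}_\delta$ is the $\mathbb{K}$-vector space with basis $\{\mathsf{F}_u : u \in \mathsf{Cl}_\delta\}$. For $n \geq 0$, $\mathrm{r}_\delta : \mathbb{N}^n \to \mathsf{Cl}_\delta(n)$ is defined by $\mathrm{r}_\delta(u)_i := \min\{u_i, \delta(i)\}$. The bilinear product of $\mathbf{Cl}_\delta$ is $$\mathsf{F}_u \cdot \mathsf{F}_v = \sum_{\substack{v' \in \mathrm{r}_\delta^{-1}(v)\\ uv' \in \mathsf{Cl}_\delta}} \mathsf{F}_{uv'},$$ where $uv'$ is the concatenation. This product is unital, and it is associative when $\delta$ is valley-free. A graded subset $\mathcal{S}$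 of $\mathsf{Cl}_\delta$ is a family $\mathcal{S} = \bigsqcup_{n\geq 0}\mathcal{S}(n)$ with $\mathcal{S}(n) \subseteq \mathsf{Cl}_\delta(n)$. It is closed by prefix if all prefixes of elements of $\mathcal{S}$ belong to $\mathcal{S}$, and closed by suffix reduction if for any $u \in \mathcal{S}$ and any suffix $u'$ of $u$, $\mathrm{r}_\delta(u') \in \mathcal{S}$. $\mathbf{Cl}_{\mathcal{S}} := \mathbf{Cl}_\delta / \mathcal{V}_{\mathcal{S}}$ is the quotient vector space, where $\mathcal{V}_{\mathcal{S}}$ is the linear span of $\{\mathsf{F}_u : u \in \mathsf{Cl}_\delta \setminus \mathcal{S}\}$. To be a quotient algebra means that $\mathcal{V}_{\mathcal{S}}$ is a two-sided ideal of $\mathbf{Cl}_\delta$, so that the product descends to $\mathbf{Cl}_{\mathcal{S}}$. *)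

theory Defs
  imports
    "HOL-Library.Sublist"
    "HOL-Library.Poly_Mapping"
    "HOL-Algebra.Module"
    "HOL-Algebra.QuotRing"
    "HOL-Algebra.Algebraic_Closure_Type"
begin

text \<open>
  A range map is a function on the positive integers; it is represented by a function
  \<open>\<delta> :: nat \<Rightarrow> nat\<close> whose value at \<open>0\<close> is never used. Words are lists, so the letter
  \<open>u\<^sub>i\<close> (with \<open>i \<ge> 1\<close>) is \<open>u ! (i - 1)\<close>.
\<close>

definition valley_free :: "(nat \<Rightarrow> nat) \<Rightarrow> bool" where
  "valley_free \<delta> \<longleftrightarrow>
     \<not> (\<exists>i\<^sub>1 i\<^sub>2 i\<^sub>3. 1 \<le> i\<^sub>1 \<and> i\<^sub>1 < i\<^sub>2 \<and> i\<^sub>2 < i\<^sub>3 \<and> \<delta> i\<^sub>1 > \<delta> i\<^sub>2 \<and> \<delta> i\<^sub>2 < \<delta> i\<^sub>3)"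

definition cliffs_of_size :: "(nat \<Rightarrow> nat) \<Rightarrow> nat \<Rightarrow> nat list set" where
  "cliffs_of_size \<delta> n = {u. length u = n \<and> (\<forall>i\<in>{1..n}. u ! (i - 1) \<le> \<delta> i)}"

definition cliffs :: "(nat \<Rightarrow> nat) \<Rightarrow> nat list set" where
  "cliffs \<delta> = (\<Union>n. cliffs_of_size \<delta> n)"

definition reduction :: "(nat \<Rightarrow> nat) \<Rightarrow> nat list \<Rightarrow> nat list" where
  "reduction \<delta> u = map (\<lambda>i. min (u ! (i - 1)) (\<delta> i)) [1..<Suc (length u)]"

lemma length_reduction [simp]: "length (reduction \<delta> u) = length u"
  by (simp add: reduction_def del: upt_Suc)

definition graded_subset :: "(nat \<Rightarrow> nat) \<Rightarrow> nat list set \<Rightarrow> bool" where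
  "graded_subset \<delta> S \<longleftrightarrow>
     (\<exists>T. (\<forall>n. T n \<subseteq> cliffs_of_size \<delta> n) \<and> S = (\<Union>n. T n))"

definition closed_by_prefix :: "nat list set \<Rightarrow> bool" where
  "closed_by_prefix S \<longleftrightarrow> (\<forall>u\<in>S. \<forall>p. prefix p u \<longrightarrow> p \<in> S)"

definition closed_by_suffix_reduction :: "(nat \<Rightarrow> nat) \<Rightarrow> nat list set \<Rightarrow> bool" where
  "closed_by_suffix_reduction \<delta> S \<longleftrightarrow> (\<forall>u\<in>S. \<forall>s. suffix s u \<longrightarrow> reduction \<delta> s \<in> S)"


text \<open>The locale \<open>algebra\<close> of the library only covers commutative algebras.\<close>

locale unital_assoc_algebra = R: field K + M: Module.module K A + A: ring A
  for K (structure) and A (structure) +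
  assumes smult_mult_left:
      "\<lbrakk>c \<in> carrier K; x \<in> carrier A; y \<in> carrier A\<rbrakk> \<Longrightarrow>
       (c \<odot>\<^bsub>A\<^esub> x) \<otimes>\<^bsub>A\<^esub> y = c \<odot>\<^bsub>A\<^esub> (x \<otimes>\<^bsub>A\<^esub> y)"
    and smult_mult_right:
      "\<lbrakk>c \<in> carrier K; x \<in> carrier A; y \<in> carrier A\<rbrakk> \<Longrightarrow>
       x \<otimes>\<^bsub>A\<^esub> (c \<odot>\<^bsub>A\<^esub> y) = c \<odot>\<^bsub>A\<^esub> (x \<otimes>\<^bsub>A\<^esub> y)"

definition algebra_hom ::
    "('k, 'm) ring_scheme \<Rightarrow> ('k, 'a, 'n) module_scheme \<Rightarrow> ('k, 'b, 'o) module_scheme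
      \<Rightarrow> ('a \<Rightarrow> 'b) set" where
  "algebra_hom K A B =
     {h \<in> ring_hom A B. \<forall>c\<in>carrier K. \<forall>x\<in>carrier A. h (c \<odot>\<^bsub>A\<^esub> x) = c \<odot>\<^bsub>B\<^esub> h x}"

text \<open>
  The ring \<open>A Quot I\<close> of the library, extended by the scalar multiplication of cosets, which
  is defined in the same way as the library's multiplication of cosets \<^const>\<open>rcoset_mult\<close>.
\<close>

definition quotient_algebra ::
    "('k, 'a, 'n) module_scheme \<Rightarrow> 'a set \<Rightarrow> ('k, 'a set) module" where
  "quotient_algebra A I =
     \<lparr>carrier = carrier (A Quot I), monoid.mult = monoid.mult (A Quot I),
      one = one (A Quot I), ring.zero = ring.zero (A Quot I), ring.add = ring.add (A Quot I),
      module.smult = (\<lambda>c C. \<Union>x\<in>C. I +>\<^bsub>A\<^esub> (c \<odot>\<^bsub>A\<^esub> x))\<rparr>"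


text \<open>
  Finitely supported functions on words carry the vector space structure. The library's
  multiplication of such functions is unrelated to the product of cliffs.
\<close>

definition scale :: "'k::field_char_0 \<Rightarrow> (nat list \<Rightarrow>\<^sub>0 'k) \<Rightarrow> (nat list \<Rightarrow>\<^sub>0 'k)" where
  "scale c f = Poly_Mapping.map ((*) c) f"

lemma lookup_scale: "Poly_Mapping.lookup (scale c f) u = c * Poly_Mapping.lookup f u"
  unfolding scale_def by transfer (simp add: when_def)

lemma vector_space_scale: "vector_space scale"
  by unfold_locales
    (auto intro!: poly_mapping_eqI simp: lookup_scale lookup_add algebra_simps)

definition fundamental :: "nat list \<Rightarrow> (nat list \<Rightarrow>\<^sub>0 'k::field_char_0)" where
  "fundamental u = Poly_Mapping.single u 1"

text \<open>The words \<open>v'\<close> over which the sum defining \<open>F\<^sub>u \<cdot> F\<^sub>v\<close> ranges.\<close>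

definition product_words :: "(nat \<Rightarrow> nat) \<Rightarrow> nat list \<Rightarrow> nat list \<Rightarrow> nat list set" where
  "product_words \<delta> u v = {v'. reduction \<delta> v' = v \<and> u @ v' \<in> cliffs \<delta>}"

lemma finite_product_words: "finite (product_words \<delta> u v)"
proof -
  let ?m = "Max (\<delta> ` {..length u + length v})"
  have "product_words \<delta> u v \<subseteq> {w. set w \<subseteq> {..?m} \<and> length w = length v}"
  proof
    fix w assume "w \<in> product_words \<delta> u v"
    then have len: "length w = length v"
      and le: "\<And>i. i \<in> {1..length u + length w} \<Longrightarrow> (u @ w) ! (i - 1) \<le> \<delta> i"
      by (auto simp: product_words_def cliffs_def cliffs_of_size_def)
    have "x \<le> ?m" if "x \<in> set w" for x
    proof -
      from that obtain j where j: "j < length w" "x = w ! j"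
        by (auto simp: in_set_conv_nth)
      with le[of "Suc (length u + j)"] have "x \<le> \<delta> (Suc (length u + j))"
        by (simp add: nth_append)
      also have "\<dots> \<le> ?m"
        using j len by (intro Max_ge) auto
      finally show ?thesis .
    qed
    with len show "w \<in> {w. set w \<subseteq> {..?m} \<and> length w = length v}" by auto
  qed
  then show ?thesis
    by (rule finite_subset) (rule finite_lists_length_eq, simp)
qed

definition fundamental_product ::
    "(nat \<Rightarrow> nat) \<Rightarrow> nat list \<Rightarrow> nat list \<Rightarrow> (nat list \<Rightarrow>\<^sub>0 'k::field_char_0)" where
  "fundamental_product \<delta> u v = (\<Sum>v'\<in>product_words \<delta> u v. fundamental (u @ v'))"

definition cliff_product ::
    "(nat \<Rightarrow> nat) \<Rightarrow> (nat list \<Rightarrow>\<^sub>0 'k::field_char_0) \<Rightarrow> (nat list \<Rightarrow>\<^sub>0 'k) \<Rightarrow> (nat list \<Rightarrow>\<^sub>0 'k)"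
  where
  "cliff_product \<delta> f g =
     (\<Sum>u\<in>Poly_Mapping.keys f. \<Sum>v\<in>Poly_Mapping.keys g.
        scale (Poly_Mapping.lookup f u * Poly_Mapping.lookup g v) (fundamental_product \<delta> u v))"

lemma cliff_product_fundamental:
  "cliff_product \<delta> (fundamental u) (fundamental v) = fundamental_product \<delta> u v"
  by (simp add: cliff_product_def fundamental_def poly_mapping_eqI lookup_scale)

definition cliff_algebra :: "(nat \<Rightarrow> nat) \<Rightarrow> ('k::field_char_0, nat list \<Rightarrow>\<^sub>0 'k) module" where
  "cliff_algebra \<delta> =
     \<lparr>carrier = {f. Poly_Mapping.keys f \<subseteq> cliffs \<delta>}, monoid.mult = cliff_product \<delta>,
      one = fundamental [], ring.zero = 0, ring.add = (+), module.smult = scale\<rparr>"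

definition complement_span ::
    "(nat \<Rightarrow> nat) \<Rightarrow> nat list set \<Rightarrow> (nat list \<Rightarrow>\<^sub>0 'k::field_char_0) set" where
  "complement_span \<delta> S = Modules.module.span scale (fundamental ` (cliffs \<delta> - S))"

definition quotient_cliff_algebra ::
    "(nat \<Rightarrow> nat) \<Rightarrow> nat list set \<Rightarrow> ('k::field_char_0, (nat list \<Rightarrow>\<^sub>0 'k) set) module" where
  "quotient_cliff_algebra \<delta> S = quotient_algebra (cliff_algebra \<delta>) (complement_span \<delta> S)"

end

theory Submission
  imports Defs
begin

text \<open>
  Everything is read off the coefficients of a product. A word \<open>x\<close> occurs in
  \<open>F\<^sub>u \<cdot> F\<^sub>v\<close> exactly when \<open>x\<close> is a cliff that begins with \<open>u\<close> and whose remaining letters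
  reduce to \<open>v\<close>. Hence the coefficient of \<open>f \<cdot> g\<close> at a cliff \<open>x\<close> is a convolution over the cut
  points of \<open>x\<close>: the sum, over all \<open>k \<le> |x|\<close>, of the coefficient of \<open>f\<close> at the prefix of
  length \<open>k\<close> times that of \<open>g\<close> at the reduction of the rest (\<open>lookup_cliff_product\<close>).
  Bilinearity and the unit laws are immediate from this formula.

  For associativity, both bracketings of \<open>f \<cdot> g \<cdot> h\<close> become sums over two cut points of \<open>x\<close>.
  They agree term by term, except that in \<open>f \<cdot> (g \<cdot> h)\<close> the last factor has been reduced twice,
  first at its place in a suffix of \<open>x\<close> and then at the start of a word, instead of only once.
  The additional reduction could lower the result only if the range map had a valley at the three
  positions that the letter in question occupies (\<open>reduction_drop_reduction\<close>).

  The span of the cliffs outside \<open>S\<close> consists of the elements whose coefficients vanish on \<open>S\<close>.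
  If \<open>x\<close> is in \<open>S\<close>, the closure properties put every prefix and every reduced suffix of \<open>x\<close>
  in \<open>S\<close>; so each term of the convolution at \<open>x\<close> vanishes as soon as one factor vanishes
  on \<open>S\<close>, and the span is a two-sided ideal (\<open>cliff_product_complement\<close>). The rest is the
  construction of the quotient of an algebra by an ideal that is also a subspace.
\<close>

section \<open>Words, cliffs and reduction\<close>

lemma in_cliffs_iff: "x \<in> cliffs \<delta> \<longleftrightarrow> (\<forall>i<length x. x ! i \<le> \<delta> (Suc i))"
  unfolding cliffs_def cliffs_of_size_def image_Suc_lessThan[symmetric]
  by auto

lemma nth_reduction [simp]:
  "i < length u \<Longrightarrow> reduction \<delta> u ! i = min (u ! i) (\<delta> (Suc i))"
  by (simp add: reduction_def del: upt_Suc)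

lemma reduction_in_cliffs: "reduction \<delta> u \<in> cliffs \<delta>"
  by (simp add: in_cliffs_iff)

lemma reduction_cliff: "u \<in> cliffs \<delta> \<Longrightarrow> reduction \<delta> u = u"
  by (rule nth_equalityI) (auto simp: in_cliffs_iff min_def)

lemma reduction_eq_Nil: "[] = reduction \<delta> u \<longleftrightarrow> u = []"
  by (metis length_0_conv length_reduction)

lemma Nil_in_cliffs: "[] \<in> cliffs \<delta>"
  by (simp add: in_cliffs_iff)

lemma take_in_cliffs: "x \<in> cliffs \<delta> \<Longrightarrow> take k x \<in> cliffs \<delta>"
  by (simp add: in_cliffs_iff)

lemma take_reduction: "take k (reduction \<delta> u) = reduction \<delta> (take k u)"
  by (rule nth_equalityI) auto

text \<open>
  The letter \<open>a = x\<^sub>j\<^sub>+\<^sub>l\<^sub>+\<^sub>i\<close> (with \<open>i \<ge> 1\<close>) is cut off at \<open>\<delta>(l + i)\<close> by the inner reduction and at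
  \<open>\<delta>(i)\<close> by the outer one. If the inner cut mattered, both \<open>\<delta>(i)\<close> and \<open>a\<close> would be greater
  than \<open>\<delta>(l + i)\<close>. Since \<open>a \<le> \<delta>(j + l + i)\<close>, the positions \<open>i < l + i < j + l + i\<close> would form a
  valley.
\<close>
lemma reduction_drop_reduction:
  assumes "valley_free \<delta>" and "x \<in> cliffs \<delta>"
  shows "reduction \<delta> (drop l (reduction \<delta> (drop j x))) = reduction \<delta> (drop (j + l) x)"
proof (rule nth_equalityI)
  show "length (reduction \<delta> (drop l (reduction \<delta> (drop j x)))) =
      length (reduction \<delta> (drop (j + l) x))"
    by simp
next
  fix i
  assume "i < length (reduction \<delta> (drop l (reduction \<delta> (drop j x))))"
  then have i: "j + l + i < length x" by simp
  let ?a = "x ! (j + l + i)"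
  have le: "?a \<le> \<delta> (Suc (j + l + i))"
    using assms(2) i by (simp add: in_cliffs_iff)
  have "min ?a (\<delta> (Suc i)) \<le> \<delta> (Suc (l + i))"
  proof (rule ccontr)
    assume "\<not> ?thesis"
    then have "\<delta> (Suc (l + i)) < \<delta> (Suc i)" "\<delta> (Suc (l + i)) < ?a" by auto
    with le have v: "\<delta> (Suc i) > \<delta> (Suc (l + i))" "\<delta> (Suc (l + i)) < \<delta> (Suc (j + l + i))"
      by auto
    \<comment> \<open>The strict inequalities separate the three positions, as a valley requires.\<close>
    then have "l \<noteq> 0" "j \<noteq> 0" by (auto intro: ccontr)
    then have "1 \<le> Suc i \<and> Suc i < Suc (l + i) \<and> Suc (l + i) < Suc (j + l + i)" by simp
    with v assms(1) show False unfolding valley_free_def by blast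
  qed
  then show "reduction \<delta> (drop l (reduction \<delta> (drop j x))) ! i =
      reduction \<delta> (drop (j + l) x) ! i"
    using i by (simp add: add.assoc)
qed


section \<open>Coefficients of a product\<close>

text \<open>
  A word has at most one factorization with a given first part, so every coefficient of a product
  of basis elements is \<open>0\<close> or \<open>1\<close>.
\<close>
lemma lookup_fundamental_product:
  "Poly_Mapping.lookup (fundamental_product \<delta> u v :: nat list \<Rightarrow>\<^sub>0 'k::field_char_0) x =
     (if x \<in> cliffs \<delta> \<and> prefix u x \<and> reduction \<delta> (drop (length u) x) = v then 1 else 0)"
proof -
  have eq: "Poly_Mapping.lookup (fundamental_product \<delta> u v :: nat list \<Rightarrow>\<^sub>0 'k) x =
      (\<Sum>v'\<in>product_words \<delta> u v. if u @ v' = x then 1 else 0)"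
    by (simp add: fundamental_product_def fundamental_def lookup_sum lookup_single when_def)
  show ?thesis
  proof (cases "prefix u x")
    case True
    then obtain w where w: "x = u @ w" by (auto simp: prefix_def)
    then show ?thesis unfolding eq
      using finite_product_words[of \<delta> u v] by (simp add: product_words_def)
  next
    case False
    then show ?thesis unfolding eq by (auto simp: prefix_def intro!: sum.neutral)
  qed
qed

text \<open>
  Summing over pairs of basis elements amounts to summing over the cut points of \<open>x\<close>: the first
  word must be a prefix of \<open>x\<close>, and the second is then determined. This is the product as the dual
  of a cutting coproduct, and all later arguments about the product use only this formula.
\<close>
lemma lookup_cliff_product:
  "Poly_Mapping.lookup (cliff_product \<delta> f g) x =
     (if x \<in> cliffs \<delta>
      then \<Sum>k\<le>length x. Poly_Mapping.lookup f (take k x)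
             * Poly_Mapping.lookup g (reduction \<delta> (drop k x))
      else 0)"
proof (cases "x \<in> cliffs \<delta>")
  case False
  then show ?thesis
    by (simp add: cliff_product_def lookup_sum lookup_scale lookup_fundamental_product)
next
  case True
  let ?f = "Poly_Mapping.lookup f" and ?g = "Poly_Mapping.lookup g"
  let ?t = "\<lambda>u. ?f u * ?g (reduction \<delta> (drop (length u) x))"
  let ?P = "{u. prefix u x}"
  have P: "?P = (\<lambda>k. take k x) ` {..length x}" (is "_ = ?T")
  proof
    show "?P \<subseteq> ?T"
    proof
      fix u assume "u \<in> ?P"
      then have "u = take (length u) x" "length u \<le> length x"
        by (auto simp: prefix_def)
      then show "u \<in> ?T" by blast
    qed
    show "?T \<subseteq> ?P"
      by (auto simp: take_is_prefix)
  qed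
  have inner: "(\<Sum>v\<in>Poly_Mapping.keys g. ?f u * ?g v *
        Poly_Mapping.lookup (fundamental_product \<delta> u v) x) = (if prefix u x then ?t u else 0)" for u
    using True by (auto simp: lookup_fundamental_product in_keys_iff if_distrib cong: if_cong)
  have "Poly_Mapping.lookup (cliff_product \<delta> f g) x =
      (\<Sum>u\<in>Poly_Mapping.keys f. if prefix u x then ?t u else 0)"
    by (simp add: cliff_product_def lookup_sum lookup_scale inner)
  also have "\<dots> = sum ?t (Poly_Mapping.keys f \<inter> ?P)"
    by (simp add: sum.inter_restrict)
  also have "\<dots> = sum ?t ?P"
    by (rule sum.mono_neutral_left) (auto simp: P in_keys_iff)
  also have "\<dots> = (\<Sum>k\<le>length x. ?t (take k x))"
  proof -
    have "inj_on (\<lambda>k. take k x) {..length x}"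
      by (rule inj_on_inverseI[where g = length]) simp
    then show ?thesis unfolding P by (simp add: sum.reindex)
  qed
  also have "\<dots> = (\<Sum>k\<le>length x. ?f (take k x) * ?g (reduction \<delta> (drop k x)))"
    by (intro sum.cong) (auto simp: min_def)
  finally show ?thesis using True by simp
qed

lemma lookup_eq_0_outside:
  "Poly_Mapping.keys f \<subseteq> B \<Longrightarrow> x \<notin> B \<Longrightarrow> Poly_Mapping.lookup f x = 0"
  by (auto simp: in_keys_iff)

lemma keys_cliff_product: "Poly_Mapping.keys (cliff_product \<delta> f g) \<subseteq> cliffs \<delta>"
  by (auto simp: in_keys_iff lookup_cliff_product split: if_splits)

text \<open>
  In \<open>(f \<cdot> g) \<cdot> h\<close> the outer cut is the later one, in \<open>f \<cdot> (g \<cdot> h)\<close> it is the earlier one. Both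
  sums are brought to the triangle of pairs \<open>(j, l)\<close> with \<open>j + l \<le> |x|\<close>, where \<open>j\<close> is the earlier
  cut and \<open>j + l\<close> the later one.
\<close>
lemma cliff_product_assoc:
  assumes "valley_free \<delta>"
  shows "cliff_product \<delta> (cliff_product \<delta> f g) h = cliff_product \<delta> f (cliff_product \<delta> g h)"
proof (rule poly_mapping_eqI)
  fix x
  let ?f = "Poly_Mapping.lookup f" and ?g = "Poly_Mapping.lookup g"
    and ?h = "Poly_Mapping.lookup h"
  show "Poly_Mapping.lookup (cliff_product \<delta> (cliff_product \<delta> f g) h) x =
      Poly_Mapping.lookup (cliff_product \<delta> f (cliff_product \<delta> g h)) x"
  proof (cases "x \<in> cliffs \<delta>")
    case False
    then show ?thesis by (simp add: lookup_cliff_product)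
  next
    case True
    let ?n = "length x"
    let ?F = "\<lambda>j l. ?f (take j x) * ?g (reduction \<delta> (take l (drop j x)))
                * ?h (reduction \<delta> (drop (j + l) x))"
    have "Poly_Mapping.lookup (cliff_product \<delta> (cliff_product \<delta> f g) h) x =
        (\<Sum>k\<le>?n. \<Sum>j\<le>k. ?F j (k - j))"
      using True
      by (auto simp: lookup_cliff_product take_in_cliffs sum_distrib_right min_def drop_take
          intro!: sum.cong)
    also have "\<dots> = (\<Sum>(j, l)\<in>{(j, l). j + l \<le> ?n}. ?F j l)"
      by (rule sum.triangle_reindex_eq[symmetric])
    also have "{(j, l). j + l \<le> ?n} = (SIGMA j:{..?n}. {..?n - j})"
      by auto
    also have "(\<Sum>(j, l)\<in>(SIGMA j:{..?n}. {..?n - j}). ?F j l) = (\<Sum>j\<le>?n. \<Sum>l\<le>?n - j. ?F j l)"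
      by (rule sum.Sigma[symmetric]) auto
    also have "\<dots> = Poly_Mapping.lookup (cliff_product \<delta> f (cliff_product \<delta> g h)) x"
      using True
      by (simp add: lookup_cliff_product reduction_in_cliffs sum_distrib_left take_reduction
          reduction_drop_reduction[OF assms True] mult.assoc)
    finally show ?thesis .
  qed
qed

lemma cliff_product_one_left:
  assumes "Poly_Mapping.keys f \<subseteq> cliffs \<delta>"
  shows "cliff_product \<delta> (fundamental []) f = f"
proof (rule poly_mapping_eqI)
  fix x
  have "(\<Sum>k\<le>length x. Poly_Mapping.lookup (fundamental []) (take k x) *
      Poly_Mapping.lookup f (reduction \<delta> (drop k x))) =
      (\<Sum>k\<le>length x. if k = 0 then Poly_Mapping.lookup f (reduction \<delta> x) else 0)"
    by (intro sum.cong) (auto simp: fundamental_def lookup_single when_def)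
  then show "Poly_Mapping.lookup (cliff_product \<delta> (fundamental []) f) x = Poly_Mapping.lookup f x"
    using lookup_eq_0_outside[OF assms, of x]
    by (auto simp: lookup_cliff_product reduction_cliff)
qed

lemma cliff_product_one_right:
  assumes "Poly_Mapping.keys f \<subseteq> cliffs \<delta>"
  shows "cliff_product \<delta> f (fundamental []) = f"
proof (rule poly_mapping_eqI)
  fix x
  have "(\<Sum>k\<le>length x. Poly_Mapping.lookup f (take k x) *
      Poly_Mapping.lookup (fundamental []) (reduction \<delta> (drop k x))) =
      (\<Sum>k\<le>length x. if k = length x then Poly_Mapping.lookup f x else 0)"
    by (intro sum.cong)
      (simp_all add: fundamental_def lookup_single when_def reduction_eq_Nil)
  then show "Poly_Mapping.lookup (cliff_product \<delta> f (fundamental [])) x = Poly_Mapping.lookup f x"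
    using lookup_eq_0_outside[OF assms, of x]
    by (simp add: lookup_cliff_product)
qed

lemma cliff_product_add_left:
  "cliff_product \<delta> (f + f') g = cliff_product \<delta> f g + cliff_product \<delta> f' g"
  by (rule poly_mapping_eqI)
    (simp add: lookup_cliff_product lookup_add distrib_right sum.distrib)

lemma cliff_product_add_right:
  "cliff_product \<delta> f (g + g') = cliff_product \<delta> f g + cliff_product \<delta> f g'"
  by (rule poly_mapping_eqI)
    (simp add: lookup_cliff_product lookup_add distrib_left sum.distrib)

lemma cliff_product_scale_left:
  "cliff_product \<delta> (scale c f) g = scale c (cliff_product \<delta> f g)"
  by (rule poly_mapping_eqI)
    (simp add: lookup_cliff_product lookup_scale sum_distrib_left mult.assoc)

lemma cliff_product_scale_right:
  "cliff_product \<delta> f (scale c g) = scale c (cliff_product \<delta> f g)"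
  by (rule poly_mapping_eqI)
    (simp add: lookup_cliff_product lookup_scale sum_distrib_left mult.left_commute)


section \<open>The algebra of cliffs\<close>

lemma keys_fundamental [simp]: "Poly_Mapping.keys (fundamental u) = {u}"
  by (simp add: fundamental_def)

lemma keys_scale_subset: "Poly_Mapping.keys (scale c f) \<subseteq> Poly_Mapping.keys f"
  by (auto simp: in_keys_iff lookup_scale)

lemma keys_add_subsetI:
  "Poly_Mapping.keys f \<subseteq> B \<Longrightarrow> Poly_Mapping.keys g \<subseteq> B \<Longrightarrow> Poly_Mapping.keys (f + g) \<subseteq> B"
  using Poly_Mapping.keys_add[of f g] by blast

lemma abelian_group_cliff_algebra:
  "abelian_group (cliff_algebra \<delta> :: ('k::field_char_0, nat list \<Rightarrow>\<^sub>0 'k) module)"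
proof (rule abelian_groupI)
  fix x :: "nat list \<Rightarrow>\<^sub>0 'k"
  assume "x \<in> carrier (cliff_algebra \<delta>)"
  then show "\<exists>y\<in>carrier (cliff_algebra \<delta>). y \<oplus>\<^bsub>cliff_algebra \<delta>\<^esub> x = \<zero>\<^bsub>cliff_algebra \<delta>\<^esub>"
    by (intro bexI[of _ "- x"]) (auto simp: cliff_algebra_def)
qed (simp_all add: cliff_algebra_def add_ac keys_add_subsetI)

lemma unital_assoc_algebra_cliff_algebra:
  assumes "valley_free \<delta>"
  shows "unital_assoc_algebra (ring_of_type_algebra :: 'k::field_char_0 ring) (cliff_algebra \<delta>)"
proof -
  let ?K = "ring_of_type_algebra :: 'k ring"
  let ?A = "cliff_algebra \<delta> :: ('k, nat list \<Rightarrow>\<^sub>0 'k) module"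
  have field: "field ?K" by (rule field_from_type_algebra)
  have module: "Module.module ?K ?A"
  proof (rule moduleI)
    show "cring ?K" by (rule cring_from_type_algebra)
    show "abelian_group ?A" by (rule abelian_group_cliff_algebra)
    fix c :: 'k and x
    assume "x \<in> carrier ?A"
    then show "c \<odot>\<^bsub>?A\<^esub> x \<in> carrier ?A"
      using keys_scale_subset[of c x] by (auto simp: cliff_algebra_def)
  qed (auto intro!: poly_mapping_eqI
      simp: cliff_algebra_def ring_of_type_algebra_def lookup_scale lookup_add algebra_simps)
  have ring: "ring ?A"
  proof (rule ringI)
    show "abelian_group ?A" by (rule abelian_group_cliff_algebra)
    show "Group.monoid ?A"
      by (rule monoidI)
        (simp_all add: cliff_algebra_def keys_cliff_product Nil_in_cliffs
          cliff_product_assoc[OF assms] cliff_product_one_left cliff_product_one_right)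
  qed (auto simp: cliff_algebra_def cliff_product_add_left cliff_product_add_right)
  show ?thesis
    by (intro unital_assoc_algebra.intro field module ring unital_assoc_algebra_axioms.intro)
      (auto simp: cliff_algebra_def cliff_product_scale_left cliff_product_scale_right)
qed


section \<open>The ideal spanned by the cliffs outside a subset\<close>

text \<open>
  The span is replaced by a condition on supports, to which the coefficient formula applies.
\<close>
lemma complement_span_eq:
  "complement_span \<delta> S = {f :: nat list \<Rightarrow>\<^sub>0 'k::field_char_0. Poly_Mapping.keys f \<subseteq> cliffs \<delta> - S}"
proof -
  interpret vector_space "scale :: 'k \<Rightarrow> _" by (rule vector_space_scale)
  let ?V = "{f :: nat list \<Rightarrow>\<^sub>0 'k. Poly_Mapping.keys f \<subseteq> cliffs \<delta> - S}"
  have "span (fundamental ` (cliffs \<delta> - S)) = ?V"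
  proof (rule span_subspace)
    show "fundamental ` (cliffs \<delta> - S) \<subseteq> ?V"
      by auto
    show "subspace ?V"
      by (intro subspaceI)
        (simp_all add: keys_add_subsetI order_trans[OF keys_scale_subset])
    show "?V \<subseteq> span (fundamental ` (cliffs \<delta> - S))"
    proof
      fix f assume f: "f \<in> ?V"
      have "f = (\<Sum>u\<in>Poly_Mapping.keys f. scale (Poly_Mapping.lookup f u) (fundamental u))"
        by (rule poly_mapping_eqI)
          (auto simp: lookup_sum lookup_scale fundamental_def lookup_single when_def in_keys_iff
            if_distrib cong: if_cong)
      also have "\<dots> \<in> span (fundamental ` (cliffs \<delta> - S))"
        using f by (intro span_sum span_scale span_base) auto
      finally show "f \<in> span (fundamental ` (cliffs \<delta> - S))" .
    qed
  qed
  then show ?thesis by (simp add: complement_span_def)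
qed

text \<open>
  Every term of the coefficient at \<open>x \<in> S\<close> pairs a prefix of \<open>x\<close> with a reduced suffix of \<open>x\<close>.
  Both are in \<open>S\<close>, so a factor whose support avoids \<open>S\<close> makes the term vanish.
\<close>
lemma cliff_product_complement:
  assumes S: "closed_by_prefix S" "closed_by_suffix_reduction \<delta> S"
    and fg: "Poly_Mapping.keys f \<inter> S = {} \<or> Poly_Mapping.keys g \<inter> S = {}"
  shows "Poly_Mapping.keys (cliff_product \<delta> f g) \<subseteq> cliffs \<delta> - S"
proof -
  have "Poly_Mapping.lookup (cliff_product \<delta> f g) x = 0" if x: "x \<in> S" for x
  proof -
    have "take k x \<in> S" "reduction \<delta> (drop k x) \<in> S" for k
      using S x take_is_prefix suffix_drop
      unfolding closed_by_prefix_def closed_by_suffix_reduction_def by blast+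
    then have "Poly_Mapping.lookup f (take k x)
        * Poly_Mapping.lookup g (reduction \<delta> (drop k x)) = 0" for k
      using fg by (auto simp: in_keys_iff disjoint_iff)
    then show ?thesis by (simp add: lookup_cliff_product del: mult_eq_0_iff)
  qed
  then show ?thesis using keys_cliff_product[of \<delta> f g] by (auto simp: in_keys_iff)
qed

lemma submodule_complement_span:
  assumes "valley_free \<delta>"
  shows "submodule (complement_span \<delta> S) (ring_of_type_algebra :: 'k::field_char_0 ring)
    (cliff_algebra \<delta>)"
proof -
  let ?K = "ring_of_type_algebra :: 'k ring"
  let ?A = "cliff_algebra \<delta> :: ('k, nat list \<Rightarrow>\<^sub>0 'k) module"
  interpret unital_assoc_algebra ?K ?A
    by (rule unital_assoc_algebra_cliff_algebra[OF assms])
  show ?thesis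
  proof (rule M.submoduleI)
    fix a assume a: "a \<in> (complement_span \<delta> S :: (nat list \<Rightarrow>\<^sub>0 'k) set)"
    have "\<ominus>\<^bsub>?A\<^esub> a = - a"
      using a by (intro M.minus_equality) (auto simp: cliff_algebra_def complement_span_eq)
    with a show "\<ominus>\<^bsub>?A\<^esub> a \<in> complement_span \<delta> S"
      by (simp add: complement_span_eq)
  next
    fix a b :: "nat list \<Rightarrow>\<^sub>0 'k"
    assume "a \<in> complement_span \<delta> S" "b \<in> complement_span \<delta> S"
    then show "a \<oplus>\<^bsub>?A\<^esub> b \<in> complement_span \<delta> S"
      using keys_add_subsetI[of a "cliffs \<delta> - S" b]
      by (simp add: complement_span_eq cliff_algebra_def)
  next
    fix c :: 'k and x assume "x \<in> (complement_span \<delta> S :: (nat list \<Rightarrow>\<^sub>0 'k) set)"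
    then show "c \<odot>\<^bsub>?A\<^esub> x \<in> complement_span \<delta> S"
      using keys_scale_subset[of c x] by (auto simp: complement_span_eq cliff_algebra_def)
  qed (auto simp: complement_span_eq cliff_algebra_def)
qed

lemma ideal_complement_span:
  assumes "valley_free \<delta>" "closed_by_prefix S" "closed_by_suffix_reduction \<delta> S"
  shows "ideal (complement_span \<delta> S)
    (cliff_algebra \<delta> :: ('k::field_char_0, nat list \<Rightarrow>\<^sub>0 'k) module)"
proof -
  let ?A = "cliff_algebra \<delta> :: ('k, nat list \<Rightarrow>\<^sub>0 'k) module"
  interpret unital_assoc_algebra "ring_of_type_algebra :: 'k ring" ?A
    by (rule unital_assoc_algebra_cliff_algebra[OF assms(1)])
  show ?thesis
  proof (rule idealI)
    show "ring ?A" by (rule A.ring_axioms)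
    show "subgroup (complement_span \<delta> S) (add_monoid ?A)"
      by (rule submodule.axioms(1)[OF submodule_complement_span[OF assms(1)]])
  next
    fix a x assume "a \<in> (complement_span \<delta> S :: (nat list \<Rightarrow>\<^sub>0 'k) set)"
    then have "Poly_Mapping.keys a \<inter> S = {}" by (auto simp: complement_span_eq)
    then show "x \<otimes>\<^bsub>?A\<^esub> a \<in> complement_span \<delta> S" "a \<otimes>\<^bsub>?A\<^esub> x \<in> complement_span \<delta> S"
      using cliff_product_complement[OF assms(2,3), where f = x and g = a]
        cliff_product_complement[OF assms(2,3), where f = a and g = x]
      by (simp_all add: complement_span_eq cliff_algebra_def)
  qed
qed


section \<open>Quotients of algebras\<close>

text \<open>
  The ring axioms only mention the fields that the quotient algebra shares with \<open>A Quot I\<close>.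
\<close>
lemma ring_quotient_algebra:
  assumes "ideal I A"
  shows "ring (quotient_algebra A I)"
proof -
  let ?Q = "quotient_algebra A I"
  interpret Q: ring "A Quot I" by (rule ideal.quotient_is_ring[OF assms])
  have sel: "carrier ?Q = carrier (A Quot I)" "(\<otimes>\<^bsub>?Q\<^esub>) = (\<otimes>\<^bsub>A Quot I\<^esub>)" "\<one>\<^bsub>?Q\<^esub> = \<one>\<^bsub>A Quot I\<^esub>"
    "\<zero>\<^bsub>?Q\<^esub> = \<zero>\<^bsub>A Quot I\<^esub>" "(\<oplus>\<^bsub>?Q\<^esub>) = (\<oplus>\<^bsub>A Quot I\<^esub>)"
    by (simp_all add: quotient_algebra_def)
  show ?thesis
  proof (rule ringI)
    show "abelian_group ?Q"
      using abelian_groupE[OF Q.is_abelian_group]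
      by (intro abelian_groupI) (simp_all add: sel)
    show "Group.monoid ?Q"
      by (rule monoidI) (simp_all add: sel Q.m_assoc)
  qed (simp_all add: sel Q.l_distr Q.r_distr)
qed

text \<open>
  The scalar multiple of a coset is a union over its representatives. All of them contribute the
  same coset because \<open>I\<close> is closed under scalar multiplication; this well-definedness is where the
  ideal has to be a submodule as well.
\<close>
lemma smult_coset:
  assumes "Module.module K A" "submodule I K A" "ideal I A"
    and c: "c \<in> carrier K" and x: "x \<in> carrier A"
  shows "c \<odot>\<^bsub>quotient_algebra A I\<^esub> (I +>\<^bsub>A\<^esub> x) = I +>\<^bsub>A\<^esub> (c \<odot>\<^bsub>A\<^esub> x)"
proof -
  interpret M: Module.module K A by fact
  interpret I: ideal I A by fact
  have "I +>\<^bsub>A\<^esub> (c \<odot>\<^bsub>A\<^esub> y) = I +>\<^bsub>A\<^esub> (c \<odot>\<^bsub>A\<^esub> x)" if y: "y \<in> I +>\<^bsub>A\<^esub> x" for y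
  proof -
    from y obtain h where h: "h \<in> I" "y = h \<oplus>\<^bsub>A\<^esub> x"
      by (auto simp: a_r_coset_def r_coset_def)
    then have "c \<odot>\<^bsub>A\<^esub> y = c \<odot>\<^bsub>A\<^esub> h \<oplus>\<^bsub>A\<^esub> c \<odot>\<^bsub>A\<^esub> x"
      using c x by (simp add: M.smult_r_distr I.a_Hcarr)
    moreover have "c \<odot>\<^bsub>A\<^esub> h \<in> I"
      using c h by (intro submodule.smult_closed[OF assms(2)])
    ultimately have "c \<odot>\<^bsub>A\<^esub> y \<in> I +>\<^bsub>A\<^esub> (c \<odot>\<^bsub>A\<^esub> x)"
      by (auto simp: a_r_coset_def r_coset_def)
    then show ?thesis
      using c x by (intro I.a_repr_independence'[symmetric]) auto
  qed
  moreover have "x \<in> I +>\<^bsub>A\<^esub> x" using x by (rule I.a_rcos_self)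
  ultimately have "(\<Union>y\<in>I +>\<^bsub>A\<^esub> x. I +>\<^bsub>A\<^esub> (c \<odot>\<^bsub>A\<^esub> y)) = I +>\<^bsub>A\<^esub> (c \<odot>\<^bsub>A\<^esub> x)"
    by (intro UN_constant_eq ballI)
  then show ?thesis
    by (simp add: quotient_algebra_def)
qed

text \<open>
  Each operation on cosets is computed on representatives, so the axioms descend from \<open>A\<close>.
\<close>
lemma quotient_algebra_is_quotient:
  assumes A: "unital_assoc_algebra K A" and sub: "submodule I K A" and ideal: "ideal I A"
  shows "unital_assoc_algebra K (quotient_algebra A I)"
    and "(\<lambda>x. I +>\<^bsub>A\<^esub> x) \<in> algebra_hom K A (quotient_algebra A I)"
proof -
  let ?Q = "quotient_algebra A I"
  interpret unital_assoc_algebra K A by fact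
  interpret I: ideal I A by fact
  interpret Q: ring ?Q by (rule ring_quotient_algebra[OF ideal])
  note smult = smult_coset[OF M.module_axioms sub ideal]
  have carrier: "carrier ?Q = (\<lambda>x. I +>\<^bsub>A\<^esub> x) ` carrier A"
    by (auto simp: quotient_algebra_def FactRing_simps)
  have hom: "(\<lambda>x. I +>\<^bsub>A\<^esub> x) \<in> ring_hom A ?Q"
    using I.rcos_ring_hom by (simp add: ring_hom_def quotient_algebra_def)
  have add: "(I +>\<^bsub>A\<^esub> x) \<oplus>\<^bsub>?Q\<^esub> (I +>\<^bsub>A\<^esub> y) = I +>\<^bsub>A\<^esub> (x \<oplus>\<^bsub>A\<^esub> y)"
    and mult: "(I +>\<^bsub>A\<^esub> x) \<otimes>\<^bsub>?Q\<^esub> (I +>\<^bsub>A\<^esub> y) = I +>\<^bsub>A\<^esub> (x \<otimes>\<^bsub>A\<^esub> y)"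
    if "x \<in> carrier A" "y \<in> carrier A" for x y
    using that ring_hom_add[OF hom] ring_hom_mult[OF hom] by simp_all
  have "Module.module K ?Q"
    by (rule moduleI)
      (auto simp: carrier smult add M.smult_l_distr M.smult_r_distr M.smult_assoc1
        intro: R.is_cring Q.is_abelian_group)
  then show "unital_assoc_algebra K ?Q"
    by (intro unital_assoc_algebra.intro unital_assoc_algebra_axioms.intro
        R.field_axioms Q.ring_axioms)
      (auto simp: carrier smult mult smult_mult_left smult_mult_right)
  show "(\<lambda>x. I +>\<^bsub>A\<^esub> x) \<in> algebra_hom K A ?Q"
    using hom by (simp add: algebra_hom_def smult)
qed


section \<open>The quotient by a set closed by prefix and suffix reduction\<close>

theorem proposition3p2p1:
  fixes \<delta> :: "nat \<Rightarrow> nat" and S :: "nat list set"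
    and K :: "'k::field_char_0 ring"
    and A :: "('k, nat list \<Rightarrow>\<^sub>0 'k) module"
    and V :: "(nat list \<Rightarrow>\<^sub>0 'k) set"
    and Q :: "('k, (nat list \<Rightarrow>\<^sub>0 'k) set) module"
  defines "K \<equiv> ring_of_type_algebra"
    and "A \<equiv> cliff_algebra \<delta>"
    and "V \<equiv> complement_span \<delta> S"
    and "Q \<equiv> quotient_cliff_algebra \<delta> S"
  assumes "valley_free \<delta>"
    and "graded_subset \<delta> S"
    and "closed_by_prefix S"
    and "closed_by_suffix_reduction \<delta> S"
  shows "unital_assoc_algebra K A \<and>
    submodule V K A \<and> ideal V A \<and>
    unital_assoc_algebra K Q \<and>
    (\<lambda>x. V +>\<^bsub>A\<^esub> x) \<in> algebra_hom K A Q"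
proof -
  have A: "unital_assoc_algebra K A"
    unfolding K_def A_def by (rule unital_assoc_algebra_cliff_algebra) fact
  have sub: "submodule V K A"
    unfolding K_def A_def V_def by (rule submodule_complement_span) fact
  have ideal: "ideal V A"
    unfolding A_def V_def by (rule ideal_complement_span) fact+
  have "Q = quotient_algebra A V"
    by (simp add: Q_def A_def V_def quotient_cliff_algebra_def)
  then show ?thesis
    using A sub ideal quotient_algebra_is_quotient[OF A sub ideal] by simp
qed

end
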